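(* Let $G$ be a branching topological multigraph with $n\ge 3$ vertices. Then the number of edges of $G$ satisfies $e(G)\le n(n-2)$. Moreover, this bound is tight: for every $n\ge 3$ there is a branching topological multigraph with $n$ vertices and exactly $n(n-2)$ edges.
   Context: Multigraphs may have parallel edges but no loops. A drawing of a multigraph represents vertices by distinct points of the plane and each edge by a simple continuous arc joining its endpoints and passing through no other vertex point; any two edges intersect in finitely many points and no three edges pass through a common point. A crossing is a common interior point of two edges at which the first edge passes from one side of the second to the other. A drawing is branching (a branching topological multigraph) if: (i) for any two parallel edges, the simple closed curve formed by their union has at least one vertex in its interior and at least one in its exterior; (ii) two edges sharing an endpoint do not cross; (iii) two edges with no common endpoint cross at most once. *)

theory Defs
  imports "HOL-Analysis.Analysis"
begin

record ('v, 'e) multigraph =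
  verts :: "'v set"
  edges :: "'e set"
  ends :: "'e \<Rightarrow> 'v set"

locale finite_multigraph =
  fixes G :: "('v, 'e) multigraph"
  assumes finite_verts: "finite (verts G)"
    and finite_edges: "finite (edges G)"
    and ends_in_verts: "e \<in> edges G \<Longrightarrow> ends G e \<subseteq> verts G"
    and no_loops: "e \<in> edges G \<Longrightarrow> card (ends G e) = 2"

text \<open>
  The plane is the type of complex numbers, for which the library proves the Jordan curve theorem.
  The parametrisation of an edge is directed, but this direction carries no meaning.  A point
  lying on three edges can only be a vertex, which by the condition on vertices on edges is then
  a common endpoint of them.
\<close>

locale multigraph_drawing = finite_multigraph G
  for G :: "('v, 'e) multigraph" +
  fixes pos :: "'v \<Rightarrow> complex"
    and curve :: "'e \<Rightarrow> real \<Rightarrow> complex"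
  assumes pos_inj: "inj_on pos (verts G)"
    and arc_curve: "e \<in> edges G \<Longrightarrow> arc (curve e)"
    and curve_ends:
      "e \<in> edges G \<Longrightarrow> {pathstart (curve e), pathfinish (curve e)} = pos ` ends G e"
    and no_other_vertex:
      "\<lbrakk>e \<in> edges G; v \<in> verts G; pos v \<in> path_image (curve e)\<rbrakk> \<Longrightarrow> v \<in> ends G e"
    and finite_intersection:
      "\<lbrakk>e \<in> edges G; f \<in> edges G; e \<noteq> f\<rbrakk>
        \<Longrightarrow> finite (path_image (curve e) \<inter> path_image (curve f))"
    and no_triple_point:
      "\<lbrakk>e \<in> edges G; f \<in> edges G; g \<in> edges G; e \<noteq> f; e \<noteq> g; f \<noteq> g;
        p \<in> path_image (curve e); p \<in> path_image (curve f); p \<in> path_image (curve g)\<rbrakk>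
        \<Longrightarrow> p \<in> pos ` verts G"

text \<open>
  At a common interior point \<open>p\<close> of two arcs \<open>g\<close> and \<open>h\<close>, the sides of \<open>h\<close> near \<open>p\<close> are the
  components of the complement of \<open>h\<close> in a neighbourhood \<open>U\<close> of \<open>p\<close>; \<open>g\<close> crosses \<open>h\<close> at \<open>p\<close> if
  it lies in one of them immediately before \<open>p\<close> and in another one immediately after.  The
  condition is local: if it holds for \<open>U\<close>, it holds for every smaller neighbourhood of \<open>p\<close>
  (after shrinking \<open>d\<close>).  A mere touching point is not a crossing.
\<close>

definition crosses_at :: "(real \<Rightarrow> complex) \<Rightarrow> (real \<Rightarrow> complex) \<Rightarrow> complex \<Rightarrow> bool" where
  "crosses_at g h p \<longleftrightarrow>
    (\<exists>s\<in>{0<..<1}. \<exists>t\<in>{0<..<1}. g s = p \<and> h t = p \<and>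
      (\<exists>U d A B. open U \<and> p \<in> U \<and> d > 0 \<and>
        A \<in> components (U - path_image h) \<and> B \<in> components (U - path_image h) \<and> A \<noteq> B \<and>
        g ` {s - d<..<s} \<subseteq> A \<and> g ` {s<..<s + d} \<subseteq> B))"

text \<open>
  The closed curve formed by two arcs with the same endpoints, whatever the directions of their
  parametrisations.
\<close>

definition closed_union :: "(real \<Rightarrow> complex) \<Rightarrow> (real \<Rightarrow> complex) \<Rightarrow> real \<Rightarrow> complex" where
  "closed_union g h =
    (if pathfinish g = pathstart h then g +++ h else g +++ reversepath h)"

text \<open>
  The first condition includes that parallel edges meet only at their endpoints: otherwise
  their union is not a simple closed curve and has no interior and exterior.
\<close>

locale branching_drawing = multigraph_drawing G pos curve
  for G :: "('v, 'e) multigraph" and pos :: "'v \<Rightarrow> complex" and curve :: "'e \<Rightarrow> real \<Rightarrow> complex" +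
  assumes parallel_simple:
      "\<lbrakk>e \<in> edges G; f \<in> edges G; e \<noteq> f; ends G e = ends G f\<rbrakk>
        \<Longrightarrow> simple_path (closed_union (curve e) (curve f))"
    and parallel_inside:
      "\<lbrakk>e \<in> edges G; f \<in> edges G; e \<noteq> f; ends G e = ends G f\<rbrakk>
        \<Longrightarrow> \<exists>v\<in>verts G. pos v \<in> inside (path_image (closed_union (curve e) (curve f)))"
    and parallel_outside:
      "\<lbrakk>e \<in> edges G; f \<in> edges G; e \<noteq> f; ends G e = ends G f\<rbrakk>
        \<Longrightarrow> \<exists>v\<in>verts G. pos v \<in> outside (path_image (closed_union (curve e) (curve f)))"
    and adjacent_no_crossing:
      "\<lbrakk>e \<in> edges G; f \<in> edges G; e \<noteq> f; ends G e \<inter> ends G f \<noteq> {}\<rbrakk>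
        \<Longrightarrow> \<not> crosses_at (curve e) (curve f) p"
    and disjoint_cross_once:
      "\<lbrakk>e \<in> edges G; f \<in> edges G; ends G e \<inter> ends G f = {};
        crosses_at (curve e) (curve f) p; crosses_at (curve e) (curve f) q\<rbrakk>
        \<Longrightarrow> p = q"

end

theory Submission imports Defs "HOL-Complex_Analysis.Winding_Numbers" begin

text \<open>
  Upper bound: every vertex \<open>v\<close> has degree at most \<open>2 (n - 2)\<close>.  The \<open>k\<close> parallel edges from \<open>v\<close> to \<open>w\<close>
  cut the plane into \<open>k\<close> regions, and branching means that each of them contains a vertex; so the
  other vertices fall into at least \<open>k\<close> classes with respect to \<open>w\<close>.  Two points are in the same
  class if the closed curves formed by pairs of these edges have the same winding numbers around
  them.  As edges at \<open>v\<close> do not cross, the classes for different \<open>w\<close> are nested like the components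
  left by removing a vertex of a tree, and the numbers of classes sum up to at most \<open>2 (n - 2)\<close>,
  the sum of the degrees of a tree on the \<open>n - 1\<close> vertices other than \<open>v\<close>.

  Tightness: in a convex polygon draw every side once and every diagonal both inside and outside.
  Here the vertices are on the real axis, and the inside and the outside are the two half-planes.
\<close>

section \<open>Tree-like families of partitions\<close>

text \<open>
  Think of the points of \<open>W\<close> as the vertices of a tree and of \<open>key w\<close> as labelling the components
  that remain when \<open>w\<close> is removed; then the sum is that of the degrees.  The induction removes a
  leaf: a point of a component that is minimal among all components of all points.
\<close>

lemma sum_card_image_separation_le:
  fixes key :: "'v \<Rightarrow> 'v \<Rightarrow> 'k"
  assumes "finite W" "card W \<ge> 2"
    and compat: "\<And>w w' x. \<lbrakk>w \<in> W; w' \<in> W; x \<in> W; w \<noteq> w'; x \<noteq> w; x \<noteq> w'\<rbrakk>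
      \<Longrightarrow> key w x = key w w' \<or> key w' x = key w' w"
  shows "(\<Sum>w\<in>W. card (key w ` (W - {w}))) \<le> 2 * (card W - 1)"
  using assms
proof (induction "card W" arbitrary: W rule: less_induct)
  case less
  note compat = less.prems(3)
  show ?case
  proof (cases "card W = 2")
    case True
    have "card (key w ` (W - {w})) \<le> 1" if "w \<in> W" for w
      using card_image_le[of "W - {w}" "key w"] less.prems(1) True that by simp
    then have "(\<Sum>w\<in>W. card (key w ` (W - {w}))) \<le> (\<Sum>w\<in>W. 1)"
      by (rule sum_mono)
    with True show ?thesis by simp
  next
    case False
    with less.prems(2) have card3: "card W \<ge> 3" by simp
    \<comment> \<open>In the tree picture, the component of \<open>W - {w}\<close> containing
      \<open>y\<close>.\<close>
    define cls where "cls = (\<lambda>(w, y). {z \<in> W - {w}. key w z = key w y})"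
    define P where "P = {(w, y). w \<in> W \<and> y \<in> W \<and> w \<noteq> y}"
    have "finite P"
      by (rule finite_subset[of _ "W \<times> W"]) (use less.prems(1) in \<open>auto simp: P_def\<close>)
    moreover have "P \<noteq> {}"
    proof -
      obtain w where w: "w \<in> W" using card3 by fastforce
      have "\<not> W \<subseteq> {w}"
        using card_mono[of "{w}" W] card3 by auto
      then obtain y where "y \<in> W" "y \<noteq> w" by blast
      with w show ?thesis by (auto simp: P_def)
    qed
    ultimately obtain p where "p \<in> P" and min_p: "\<forall>q\<in>P. card (cls p) \<le> card (cls q)"
      using obtains_MIN[of P "\<lambda>q. card (cls q)"] Min_le[of "(\<lambda>q. card (cls q)) ` P"]
      by (metis finite_imageI imageI)
    then obtain w x where wx: "w \<in> W" "x \<in> W" "w \<noteq> x"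
      and min: "\<And>w' y. \<lbrakk>w' \<in> W; y \<in> W; w' \<noteq> y\<rbrakk> \<Longrightarrow> card (cls (w, x)) \<le> card (cls (w', y))"
      by (auto simp: P_def)
    \<comment> \<open>A component at \<open>x\<close> without \<open>w\<close> would lie strictly inside the minimal one.\<close>
    have key_x: "key x y = key x w" if y: "y \<in> W - {x}" for y
    proof (rule ccontr)
      assume neq: "key x y \<noteq> key x w"
      have "cls (x, y) \<subset> cls (w, x)"
      proof
        \<comment> \<open>For \<open>z\<close> in \<open>cls (x, y)\<close>, \<open>key x z\<close>
          differs from \<open>key x w\<close>, so \<open>compat\<close> forces
          \<open>key w z = key w x\<close>. The point \<open>x\<close> itself makes the inclusion
          strict.\<close>
        show "cls (x, y) \<subseteq> cls (w, x)"
          using compat[of w x] wx neq by (fastforce simp: cls_def)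
        show "cls (x, y) \<noteq> cls (w, x)"
          using wx by (auto simp: cls_def)
      qed
      moreover have "finite (cls (w, x))" using less.prems(1) by (simp add: cls_def)
      ultimately have "card (cls (x, y)) < card (cls (w, x))" by (rule psubset_card_mono[rotated])
      with min[of x y] y wx show False by auto
    qed
    define W' where "W' = W - {x}"
    have W: "finite W'" "W = insert x W'" "x \<notin> W'" "card W = Suc (card W')"
      using card_Suc_Diff1[OF less.prems(1) wx(2)] less.prems(1) wx by (auto simp: W'_def)
    \<comment> \<open>Here \<open>x\<close> forms a component of its own at \<open>w'\<close>, so
      that deleting \<open>x\<close> costs \<open>w'\<close> one label. Only one neighbour of a leaf
      loses a label: for two such points, \<open>compat\<close> would give \<open>x\<close> at one
      of them the label of the other.\<close>
    define Q where "Q w' \<longleftrightarrow> key w' x \<notin> key w' ` (W' - {w'})" for w'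
    have "card (key w' ` (W - {w'})) \<le> card (key w' ` (W' - {w'})) + (if Q w' then 1 else 0)"
      if "w' \<in> W'" for w'
    proof -
      have "W - {w'} = insert x (W' - {w'})" using W that by auto
      then show ?thesis using W(1) by (auto simp: Q_def card_insert_if)
    qed
    then have "(\<Sum>w'\<in>W'. card (key w' ` (W - {w'})))
        \<le> (\<Sum>w'\<in>W'. card (key w' ` (W' - {w'})) + (if Q w' then 1 else 0))"
      by (rule sum_mono)
    also have "\<dots> = (\<Sum>w'\<in>W'. card (key w' ` (W' - {w'}))) + card {w' \<in> W'. Q w'}"
      using W(1) by (simp add: sum.distrib sum.If_cases Int_def)
    also have "(\<Sum>w'\<in>W'. card (key w' ` (W' - {w'}))) \<le> 2 * (card W' - 1)"
      by (rule less.hyps) (use W card3 compat in auto)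
    also have "card {w' \<in> W'. Q w'} \<le> 1"
    proof -
      have "w1 = w2" if "w1 \<in> W'" "w2 \<in> W'" "Q w1" "Q w2" for w1 w2
        using compat[of w1 w2 x] that W unfolding Q_def by (metis DiffI empty_iff imageI insertE insertI1 insertI2)
      then show ?thesis using W(1) by (auto simp: card_le_Suc0_iff_eq)
    qed
    finally have "(\<Sum>w'\<in>W'. card (key w' ` (W - {w'}))) \<le> 2 * (card W' - 1) + 1" by simp
    moreover have "card (key x ` (W - {x})) \<le> 1"
    proof -
      have "key x ` (W - {x}) \<subseteq> {key x w}" using key_x by auto
      from card_mono[OF _ this] show ?thesis by simp
    qed
    moreover have "(\<Sum>w'\<in>W. card (key w' ` (W - {w'})))
        = card (key x ` (W - {x})) + (\<Sum>w'\<in>W'. card (key w' ` (W - {w'})))"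
      unfolding W'_def by (rule sum.remove) (use less.prems wx in auto)
    ultimately show ?thesis using W card3 by simp
  qed
qed

section \<open>Counting the regions cut out by parallel edges\<close>

text \<open>Suitably ordered, the elements of \<open>E\<close> have pointwise increasing values, and
  the last exceeds the first by at most 1. So each \<open>x\<close> sees at most one jump; every gap
  between neighbours is the jump of some \<open>x\<close>, and some \<open>x\<close> has none. The
  induction removes the last element.\<close>

lemma card_le_card_separation_keys:
  fixes a :: "'x \<Rightarrow> 'e \<Rightarrow> real"
  assumes "finite X" "X \<noteq> {}" "finite E"
    and "\<And>e f. \<lbrakk>e \<in> E; f \<in> E; e \<noteq> f\<rbrakk>
      \<Longrightarrow> (\<forall>x\<in>X. a x f - a x e \<in> {0, 1}) \<or> (\<forall>x\<in>X. a x e - a x f \<in> {0, 1})"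
    and "\<And>e f. \<lbrakk>e \<in> E; f \<in> E; e \<noteq> f\<rbrakk> \<Longrightarrow> \<exists>x\<in>X. a x e \<noteq> a x f"
    and "\<And>e f. \<lbrakk>e \<in> E; f \<in> E; e \<noteq> f\<rbrakk> \<Longrightarrow> \<exists>x\<in>X. a x e = a x f"
  shows "card E \<le> card ((\<lambda>x. {(e, f) \<in> E \<times> E. a x e \<noteq> a x f}) ` X)"
proof -
  \<comment> \<open>The relation "\<open>a x e \<le> a x f\<close> for all \<open>x\<close>" is a linear order on \<open>E\<close>, with this rank function.\<close>
  define r where "r e = (\<Sum>x\<in>X. a x e)" for e
  have step: "a x f - a x e \<in> {0, 1}" if ef: "e \<in> E" "f \<in> E" "r e \<le> r f" and x: "x \<in> X" for e f x
  proof (cases "e = f")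
    case False
    show ?thesis
    proof (rule ccontr)
      assume "\<not> ?thesis"
      with assms(4)[OF ef(1,2) False] x have le: "\<forall>x\<in>X. a x e - a x f \<in> {0, 1}" by blast
      have "r f < r e" unfolding r_def
      proof (rule sum_strict_mono_ex1)
        show "\<forall>x\<in>X. a x f \<le> a x e" using le by force
        show "\<exists>x\<in>X. a x f < a x e" using le assms(5)[OF ef(1,2) False] by force
      qed (fact assms(1))
      with ef(3) show False by simp
    qed
  qed simp
  define K where "K F x = {(e, f) \<in> F \<times> F. a x e \<noteq> a x f}" for F x
  have "card F \<le> card (K F ` X)" if "F \<subseteq> E" for F
    using that
  proof (induction "card F" arbitrary: F)
    case (Suc n)
    have "finite F" using Suc.prems assms(3) finite_subset by blast
    have max_r: "\<exists>m\<in>S. \<forall>e\<in>S. r e \<le> r m" if S: "S \<subseteq> F" "S \<noteq> {}" for S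
    proof -
      have "finite S" using S \<open>finite F\<close> finite_subset by blast
      moreover obtain m where "m \<in> S" "Max (r ` S) = r m"
        using obtains_MAX[OF \<open>finite S\<close> S(2)] .
      ultimately show ?thesis using Max_ge[of "r ` S"] by auto
    qed
    obtain m where m: "m \<in> F" "\<And>e. e \<in> F \<Longrightarrow> r e \<le> r m"
      using max_r[of F] Suc.hyps(2) by fastforce
    define F' where "F' = F - {m}"
    have n: "n = card F'" using m Suc.hyps(2) \<open>finite F\<close> by (simp add: F'_def)
    have IH: "card F' \<le> card (K F' ` X)"
      by (rule Suc.hyps(1)[OF n]) (use Suc.prems in \<open>auto simp: F'_def\<close>)
    show ?case
    proof (cases "F' = {}")
      case True
      then have "card F = 1" using n Suc.hyps(2) by simp
      moreover have "card (K F ` X) > 0" using assms(1,2) by (simp add: card_gt_0_iff)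
      ultimately show ?thesis by simp
    next
      case False
      then obtain m' where m': "m' \<in> F'" "\<And>e. e \<in> F' \<Longrightarrow> r e \<le> r m'"
        using max_r[of F'] by (auto simp: F'_def)
      have mm': "m' \<in> E" "m \<in> E" "m' \<noteq> m" "m' \<in> F" using m m' Suc.prems by (auto simp: F'_def)
      obtain x where x: "x \<in> X" "a x m' \<noteq> a x m" using assms(5)[OF mm'(1-3)] by blast
      have xm: "a x m - a x m' = 1" using step[OF mm'(1,2) m(2)[OF mm'(4)] x(1)] x(2) by auto
      \<comment> \<open>Along the order \<open>a x\<close> rises by at most 1, and it does so
        between \<open>m'\<close> and \<open>m\<close>.\<close>
      have Kx: "a x e = a x m'" if "e \<in> F'" for e
      proof -
        have "e \<in> F" "e \<in> E" using that Suc.prems by (auto simp: F'_def)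
        with step[of e m' x] step[of e m x] m(2) m'(2)[OF that] mm' x(1) xm
        show ?thesis by auto
      qed
      obtain l where l: "l \<in> F" "\<And>e. e \<in> F \<Longrightarrow> r l \<le> r e"
        using obtains_MIN[of F r] Min_le[of "r ` F"] \<open>finite F\<close> m(1)
        by (metis empty_iff finite_imageI imageI)
      \<comment> \<open>By monotonicity, a point that does not separate the least element from the
        greatest separates no pair in \<open>F\<close>.\<close>
      obtain y where y: "y \<in> X" "a y l = a y m"
        using assms(6)[of l m] l(1) m(1) Suc.prems assms(2) by (metis all_not_in_conv subsetD)
      have Ky: "a y e = a y m" if "e \<in> F" for e
      proof -
        have "e \<in> E" "l \<in> E" using that l(1) Suc.prems by auto
        with step[of l e y] step[of e m y] l(2) m(2) mm' y that show ?thesis by auto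
      qed
      have neqxy: "K F x \<noteq> K F y"
      proof -
        have "(m', m) \<in> K F x" using x(2) m(1) mm'(4) by (simp add: K_def)
        moreover have "(m', m) \<notin> K F y" using Ky[OF mm'(4)] by (simp add: K_def)
        ultimately show ?thesis by metis
      qed
      have eqxy: "K F' x = K F' y"
        using Kx Ky by (auto simp: K_def F'_def)
      \<comment> \<open>Forgetting \<open>m\<close> merges the patterns of \<open>x\<close> and
        \<open>y\<close>, so fewer patterns remain on \<open>F'\<close>.\<close>
      define res where "res S = S \<inter> F' \<times> F'" for S :: "('e \<times> 'e) set"
      have res: "res (K F z) = K F' z" for z by (auto simp: K_def res_def F'_def)
      then have "K F' ` X = res ` (K F ` X)" by (simp add: image_image)
      also have "\<dots> = res ` (K F ` X - {K F x})"
      proof -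
        have "res (K F x) = res (K F y)" by (simp add: res eqxy)
        with neqxy y(1) have "res (K F x) \<in> res ` (K F ` X - {K F x})" by auto
        moreover have "insert (K F x) (K F ` X - {K F x}) = K F ` X" using x(1) by auto
        ultimately show ?thesis by (metis image_insert insert_absorb)
      qed
      finally have "card (K F' ` X) \<le> card (K F ` X - {K F x})"
        using card_image_le[of "K F ` X - {K F x}" res] assms(1) by simp
      also have "\<dots> < card (K F ` X)"
        by (rule card_Diff1_less) (use assms(1) x in auto)
      finally show ?thesis using IH n Suc.hyps(2) by simp
    qed
  qed simp
  from this[of E] show ?thesis by (simp add: K_def[abs_def])
qed

section \<open>The edges at a vertex\<close>

text \<open>The infimum of the parameters in \<open>{a..b}\<close> mapped to \<open>B\<close> works:
  earlier points where the path touches the boundary and returns to \<open>A\<close> are passed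
  over. Finiteness of the exceptional set gives the clean intervals on both sides that
  \<open>crosses_at\<close> demands.\<close>

lemma path_switch_point:
  fixes g :: "real \<Rightarrow> 'a::topological_space"
  assumes cont: "continuous_on {0..1} g"
    and AB: "open A" "open B" "A \<inter> B = {}"
    and fin: "finite {s \<in> {0..1}. g s \<notin> A \<union> B}"
    and ab: "0 \<le> a" "a < b" "b \<le> 1" "g a \<in> A" "g b \<in> B"
  shows "\<exists>s\<in>{0<..<1}. g s \<notin> A \<union> B \<and>
    (\<exists>d>0. g ` {s - d<..<s} \<subseteq> A \<and> g ` {s<..<s + d} \<subseteq> B)"
proof -
  define S where "S = {s \<in> {a..b}. g s \<in> B}"
  define \<sigma> where "\<sigma> = Inf S"
  have S: "b \<in> S" "bdd_below S" using ab by (auto simp: S_def)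
  have \<sigma>: "a \<le> \<sigma>" "\<sigma> \<le> b"
    using S ab by (auto simp: \<sigma>_def S_def intro!: cInf_lower cInf_greatest)
  have not_B: "g s \<notin> B" if "a \<le> s" "s < \<sigma>" for s
    using cInf_lower[of s S] S that \<sigma> by (auto simp: \<sigma>_def S_def)
  have nhd: "\<exists>d>0. \<forall>s\<in>{0..1}. \<bar>s - t\<bar> < d \<longrightarrow> g s \<in> U" if "open U" "t \<in> {0..1}" "g t \<in> U" for U t
  proof -
    obtain V where V: "open V" "V \<inter> {0..1} = g -` U \<inter> {0..1}"
      using cont \<open>open U\<close> by (metis continuous_on_open_invariant)
    then have "t \<in> V" using that by auto
    then obtain d where "d > 0" "\<forall>s. dist s t < d \<longrightarrow> s \<in> V" using V(1) open_dist by metis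
    then show ?thesis using V(2) by (intro exI[of _ d]) (auto simp: dist_real_def)
  qed
  have mem: "\<sigma> \<in> {0..1}" using \<sigma> ab by auto
  have near: "\<exists>s\<in>S. s < \<sigma> + d" if "d > 0" for d
    using cInf_lessD[of S "\<sigma> + d"] S that by (auto simp: \<sigma>_def)
  have "g \<sigma> \<notin> A"
  proof
    assume "g \<sigma> \<in> A"
    from nhd[OF AB(1) mem this] obtain d where d: "d > 0" "\<forall>s\<in>{0..1}. \<bar>s - \<sigma>\<bar> < d \<longrightarrow> g s \<in> A" by blast
    from near[OF d(1)] obtain s where s: "s \<in> S" "s < \<sigma> + d" by blast
    then have "\<sigma> \<le> s" using cInf_lower S by (auto simp: \<sigma>_def)
    with s d(2) ab have "g s \<in> A" by (auto simp: S_def)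
    with s(1) AB(3) show False by (auto simp: S_def)
  qed
  with ab(4) \<sigma> have "a < \<sigma>" by (metis less_eq_real_def)
  have "g \<sigma> \<notin> B"
  proof
    assume "g \<sigma> \<in> B"
    from nhd[OF AB(2) mem this] obtain d where d: "d > 0" "\<forall>s\<in>{0..1}. \<bar>s - \<sigma>\<bar> < d \<longrightarrow> g s \<in> B" by blast
    define s where "s = max a (\<sigma> - d / 2)"
    have "a \<le> s" "s < \<sigma>" "\<bar>s - \<sigma>\<bar> < d" "s \<in> {0..1}"
      using \<open>a < \<sigma>\<close> d(1) mem ab by (auto simp: s_def)
    with not_B d(2) show False by blast
  qed
  with \<open>g \<sigma> \<notin> A\<close> have sw: "g \<sigma> \<notin> A \<union> B" by blast
  with ab(5) \<sigma> have "\<sigma> < b" by (metis UnI2 less_eq_real_def)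
  define K where "K = {s \<in> {0..1}. g s \<notin> A \<union> B} - {\<sigma>}"
  have "finite K" using fin by (simp add: K_def)
  then have "open (- K)" by (simp add: finite_imp_closed open_Compl)
  moreover have "\<sigma> \<in> - K" by (simp add: K_def)
  ultimately obtain e where e: "e > 0" "\<And>s. \<bar>s - \<sigma>\<bar> < e \<Longrightarrow> s \<notin> K"
    by (metis ComplD dist_real_def open_dist)
  define d where "d = min e (min (\<sigma> - a) (b - \<sigma>))"
  have d: "d > 0" "d \<le> e" "d \<le> \<sigma> - a" "d \<le> b - \<sigma>"
    using e \<open>a < \<sigma>\<close> \<open>\<sigma> < b\<close> by (auto simp: d_def)
  have in_AB: "g s \<in> A \<union> B" if "\<bar>s - \<sigma>\<bar> < d" "s \<noteq> \<sigma>" for s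
  proof -
    have "s \<in> {0..1}" using that d ab by auto
    with e(2)[of s] that d(2) show ?thesis by (auto simp: K_def)
  qed
  have left: "g ` {\<sigma> - d<..<\<sigma>} \<subseteq> A"
  proof safe
    fix s assume s: "s \<in> {\<sigma> - d<..<\<sigma>}"
    with d(3) have "g s \<notin> B" by (intro not_B) auto
    with in_AB[of s] s show "g s \<in> A" by auto
  qed
  have right: "g ` {\<sigma><..<\<sigma> + d} \<subseteq> B"
  proof -
    let ?R = "g ` {\<sigma><..<\<sigma> + d}"
    have "{\<sigma><..<\<sigma> + d} \<subseteq> {0..1}" using d ab \<sigma> by auto
    then have "connected ?R"
      by (intro connected_continuous_image continuous_on_subset[OF cont]) auto
    moreover have "?R \<subseteq> A \<union> B"
    proof
      fix y assume "y \<in> ?R"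
      then obtain s where "s \<in> {\<sigma><..<\<sigma> + d}" "y = g s" by blast
      with in_AB[of s] show "y \<in> A \<union> B" by auto
    qed
    moreover have "B \<inter> ?R \<noteq> {}"
    proof -
      from near[OF d(1)] obtain s where s: "s \<in> S" "s < \<sigma> + d" by blast
      then have "\<sigma> \<le> s" using cInf_lower S by (auto simp: \<sigma>_def)
      moreover have "s \<noteq> \<sigma>" using s(1) sw by (auto simp: S_def)
      ultimately show ?thesis using s by (auto simp: S_def)
    qed
    ultimately have "A \<inter> ?R = {}"
      using connectedD[of ?R A B] AB by blast
    with \<open>?R \<subseteq> A \<union> B\<close> show ?thesis by blast
  qed
  show ?thesis using left right d(1) sw \<open>a < \<sigma>\<close> \<open>\<sigma> < b\<close> ab by (intro bexI[of _ \<sigma>]) auto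
qed

lemma winding_number_join_reversepath:
  assumes "path g" "path h" "pathfinish g = pathfinish h"
    and "z \<notin> path_image g" "z \<notin> path_image h"
  shows "winding_number (g +++ reversepath h) z = winding_number g z - winding_number h z"
  using assms by (simp add: winding_number_join winding_number_reversepath)

context multigraph_drawing
begin

text \<open>The direction of \<open>curve e\<close> is arbitrary. With all edges directed away from
  \<open>v\<close>, the winding number of a closed curve made of two parallel edges is a difference
  of one term per edge.\<close>

definition out_curve :: "'v \<Rightarrow> 'e \<Rightarrow> real \<Rightarrow> complex" where
  "out_curve v e = (if pathstart (curve e) = pos v then curve e else reversepath (curve e))"

lemma ends_doubleton:
  assumes "e \<in> edges G" "ends G e = {v, w}"
  shows "v \<noteq> w" "v \<in> verts G" "w \<in> verts G" "pos v \<noteq> pos w"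
    "{pathstart (curve e), pathfinish (curve e)} = {pos v, pos w}"
proof -
  show "v \<noteq> w" using no_loops[OF assms(1)] assms(2) by auto
  moreover show "v \<in> verts G" "w \<in> verts G" using ends_in_verts assms by auto
  ultimately show "pos v \<noteq> pos w" using pos_inj by (auto simp: inj_on_def)
  show "{pathstart (curve e), pathfinish (curve e)} = {pos v, pos w}"
    using curve_ends[OF assms(1)] assms(2) by simp
qed

lemma out_curve:
  assumes "e \<in> edges G" "ends G e = {v, w}"
  shows "arc (out_curve v e)" "path_image (out_curve v e) = path_image (curve e)"
    "pathstart (out_curve v e) = pos v" "pathfinish (out_curve v e) = pos w"
  using ends_doubleton[OF assms] arc_curve[OF assms(1)]
  by (auto simp: out_curve_def arc_reversepath doubleton_eq_iff)

lemma path_image_closed_union: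
  assumes "e \<in> edges G" "f \<in> edges G" "ends G e = ends G f"
  shows "path_image (closed_union (curve e) (curve f)) = path_image (curve e) \<union> path_image (curve f)"
proof -
  obtain v w where "ends G e = {v, w}" using no_loops[OF assms(1)] by (auto simp: card_2_iff)
  with ends_doubleton[of e v w] ends_doubleton[of f v w] assms show ?thesis
    unfolding closed_union_def by (auto simp: path_image_join doubleton_eq_iff)
qed

lemma pos_notin_curve:
  assumes "e \<in> edges G" "v \<in> verts G" "v \<notin> ends G e"
  shows "pos v \<notin> path_image (curve e)"
  using no_other_vertex assms by blast

end

section \<open>Lenses formed by parallel edges\<close>

context branching_drawing
begin

text \<open>For parallel edges at \<open>v\<close>, the same point set as
  \<open>closed_union\<close>, but directed according to the order of \<open>e\<close> and
  \<open>f\<close>.\<close>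

definition lens :: "'v \<Rightarrow> 'e \<Rightarrow> 'e \<Rightarrow> real \<Rightarrow> complex" where
  "lens v e f = out_curve v e +++ reversepath (out_curve v f)"

context
  fixes e f v w
  assumes ef: "e \<in> edges G" "f \<in> edges G" "e \<noteq> f" "ends G e = {v, w}" "ends G f = {v, w}"
begin

lemma path_image_lens: "path_image (lens v e f) = path_image (curve e) \<union> path_image (curve f)"
  using out_curve[of e v w] out_curve[of f v w] ef by (simp add: lens_def path_image_join)

lemma parallel_Int: "path_image (curve e) \<inter> path_image (curve f) \<subseteq> {pos v, pos w}"
proof -
  have "simple_path (closed_union (curve e) (curve f))" using parallel_simple ef by simp
  with ends_doubleton[of e v w] ends_doubleton[of f v w] ef show ?thesis
    unfolding closed_union_def
    by (auto simp: simple_path_join_loop_eq doubleton_eq_iff split: if_splits)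
qed

lemma simple_lens: "simple_path (lens v e f)" "pathfinish (lens v e f) = pathstart (lens v e f)"
  unfolding lens_def
  using out_curve[of e v w] out_curve[of f v w] ef parallel_Int
  by (auto simp: simple_path_join_loop_eq arc_reversepath)

lemma winding_number_lens:
  assumes "z \<notin> path_image (lens v e f)"
  shows "winding_number (lens v e f) z = winding_number (out_curve v e) z - winding_number (out_curve v f) z"
  using out_curve[of e v w] out_curve[of f v w] ef assms
  by (auto simp: lens_def path_image_lens[unfolded lens_def] arc_imp_path
      intro!: winding_number_join_reversepath)

lemma lens_sides:
  "inside (path_image (lens v e f)) \<in> components (- path_image (lens v e f))"
  "outside (path_image (lens v e f)) \<in> components (- path_image (lens v e f))"
  "open (inside (path_image (lens v e f)))" "open (outside (path_image (lens v e f)))"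
  "frontier (inside (path_image (lens v e f))) = path_image (lens v e f)"
  "frontier (outside (path_image (lens v e f))) = path_image (lens v e f)"
  using Jordan_inside_outside[OF simple_lens]
  by (auto simp: inside_in_components outside_in_components)

text \<open>At a switch, the point \<open>p\<close> lies on exactly one of \<open>e\<close> and
  \<open>f\<close>: it is interior to \<open>g\<close>, which avoids \<open>pos w\<close>, and
  \<open>e\<close> and \<open>f\<close> meet only at their ends. There \<open>g\<close> crosses that
  edge although they share \<open>v\<close>.\<close>

lemma no_side_switch:
  assumes g: "g \<in> edges G" "ends G g = {v, w'}" "w' \<noteq> w"
    and AB: "A \<in> components (- path_image (lens v e f))" "B \<in> components (- path_image (lens v e f))"
      "A \<noteq> B" "open A" "open B" "A \<union> B = - path_image (lens v e f)"
    and ab: "0 \<le> a" "a < b" "b \<le> 1" "curve g a \<in> A" "curve g b \<in> B"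
  shows False
proof -
  let ?J = "path_image (lens v e f)"
  have "A \<inter> B = {}" using AB(1-3) components_nonoverlap by blast
  have "v \<noteq> w" using ends_doubleton(1)[of e v w] ef by blast
  then have ne: "g \<noteq> e" "g \<noteq> f" using g ef by (auto simp: doubleton_eq_iff)
  have arc: "arc (curve g)" by (rule arc_curve[OF g(1)])
  then have inj: "inj_on (curve g) {0..1}" by (simp add: arc_def)
  have "finite (path_image (curve g) \<inter> ?J)"
    unfolding path_image_lens Int_Un_distrib
    using finite_intersection[of g e] finite_intersection[of g f] g ef ne by simp
  moreover have "curve g ` {s \<in> {0..1}. curve g s \<notin> A \<union> B} \<subseteq> path_image (curve g) \<inter> ?J"
    using AB(6) by (auto simp: path_image_def)
  ultimately have "finite (curve g ` {s \<in> {0..1}. curve g s \<notin> A \<union> B})"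
    by (rule finite_subset[rotated])
  then have "finite {s \<in> {0..1}. curve g s \<notin> A \<union> B}"
    by (rule finite_imageD) (rule inj_on_subset[OF inj], auto)
  moreover have "continuous_on {0..1} (curve g)"
    using arc by (simp add: arc_def path_def)
  ultimately obtain s d where s: "s \<in> {0<..<1}" "curve g s \<notin> A \<union> B" and d: "d > 0"
    "curve g ` {s - d<..<s} \<subseteq> A" "curve g ` {s<..<s + d} \<subseteq> B"
    using path_switch_point[of "curve g" A B a b] AB ab \<open>A \<inter> B = {}\<close> by blast
  define p where "p = curve g s"
  have "p \<notin> {pathstart (curve g), pathfinish (curve g)}"
    using s(1) inj_onD[OF inj, of s 0] inj_onD[OF inj, of s 1]
    by (auto simp: p_def pathstart_def pathfinish_def)
  then have "p \<noteq> pos v"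
    using ends_doubleton(5)[OF g(1,2)] by auto
  moreover have "p \<noteq> pos w"
  proof -
    have "p \<in> path_image (curve g)" using s(1) by (simp add: p_def path_image_def)
    with pos_notin_curve[of g w] g ends_doubleton(3)[of e v w] \<open>v \<noteq> w\<close> ef show ?thesis by auto
  qed
  ultimately have p: "p \<notin> {pos v, pos w}" by simp
  have crosses: "crosses_at (curve g) (curve h) p"
    if h: "h \<in> edges G" "ends G h = {v, w}" "p \<in> path_image (curve h)"
      and h': "h' \<in> edges G" "p \<notin> path_image (curve h')" "?J = path_image (curve h') \<union> path_image (curve h)"
    for h h'
  proof -
    obtain t where t: "t \<in> {0..1}" "curve h t = p" using h(3) by (auto simp: path_image_def)
    have "p \<noteq> pathstart (curve h)" "p \<noteq> pathfinish (curve h)"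
      using p ends_doubleton(5)[OF h(1,2)] by auto
    with t have "t \<in> {0<..<1}" by (auto simp: pathstart_def pathfinish_def less_le)
    \<comment> \<open>\<open>crosses_at\<close> lets us take the whole complement of \<open>h'\<close> as neighbourhood, where the sides
      of \<open>h\<close> are those of the Jordan curve.\<close>
    moreover have "open (- path_image (curve h'))"
      using arc_curve[OF h'(1)] by (simp add: closed_arc_image open_Compl)
    moreover have "- path_image (curve h') - path_image (curve h) = - ?J"
      using h'(3) by blast
    ultimately show ?thesis
      unfolding crosses_at_def using s(1) t(2) h'(2) d AB(1-3) p_def
      by (metis ComplI)
  qed
  have "p \<in> ?J" using s(2) AB(6) by (auto simp: p_def)
  then consider "p \<in> path_image (curve e)" "p \<notin> path_image (curve f)"
    | "p \<in> path_image (curve f)" "p \<notin> path_image (curve e)"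
    using path_image_lens parallel_Int p by blast
  then show False
  proof cases
    case 1
    with crosses[of e f] adjacent_no_crossing[of g e p] ef g ne path_image_lens show False by auto
  next
    case 2
    with crosses[of f e] adjacent_no_crossing[of g f p] ef g ne path_image_lens show False by auto
  qed
qed

lemma adjacent_in_side:
  assumes g: "g \<in> edges G" "ends G g = {v, w'}" "w' \<noteq> w"
    and AB: "A \<in> components (- path_image (lens v e f))" "B \<in> components (- path_image (lens v e f))"
      "A \<noteq> B" "open A" "open B" "A \<union> B = - path_image (lens v e f)"
    and "pos w' \<in> A"
  shows "path_image (curve g) \<inter> B = {}"
proof (rule ccontr)
  assume "\<not> ?thesis"
  then obtain q where "q \<in> path_image (curve g)" "q \<in> B" by blast
  then obtain t where t: "t \<in> {0..1}" "curve g t \<in> B" by (auto simp: path_image_def)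
  have "pos w' \<in> path_image (curve g)"
    using ends_doubleton(5)[OF g(1,2)] by (metis insertI1 insert_commute insertE pathfinish_in_path_image pathstart_in_path_image singletonD)
  then obtain s where s: "s \<in> {0..1}" "curve g s \<in> A" using assms(10) by (auto simp: path_image_def)
  have "A \<inter> B = {}" using AB(1-3) components_nonoverlap by blast
  with s t have "s \<noteq> t" by blast
  \<comment> \<open>\<open>no_side_switch\<close> follows the parametrisation, whose direction is
    unknown; in the second case \<open>A\<close> and \<open>B\<close> trade places.\<close>
  then consider "s < t" | "t < s" by linarith
  then show False
  proof cases
    case 1
    then show ?thesis using no_side_switch[OF g AB, of s t] s t by auto
  next
    case 2
    then show ?thesis using no_side_switch[OF g AB(2,1) _ AB(5,4), of t s] s t AB(3,6) by auto
  qed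
qed

end

section \<open>Separation keys and the degree bound\<close>

definition star :: "'v \<Rightarrow> 'v \<Rightarrow> 'e set" where
  "star v w = {e \<in> edges G. ends G e = {v, w}}"

text \<open>
  Not an integer, since the curve is not closed; only differences along parallel edges matter.
\<close>

definition height :: "'v \<Rightarrow> 'v \<Rightarrow> 'e \<Rightarrow> real" where
  "height v x e = Re (winding_number (out_curve v e) (pos x))"

text \<open>For a vertex \<open>x\<close> other than \<open>v\<close> and \<open>w\<close>, the
  pairs of edges whose lens has \<open>x\<close> inside. This set labels the region of
  \<open>x\<close> without introducing the regions themselves.\<close>

definition key :: "'v \<Rightarrow> 'v \<Rightarrow> 'v \<Rightarrow> ('e \<times> 'e) set" where
  "key v w x = {(e, f) \<in> star v w \<times> star v w. height v x e \<noteq> height v x f}"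

lemma lens_height:
  assumes "e \<in> star v w" "f \<in> star v w" "e \<noteq> f" "x \<in> verts G - {v, w}"
  shows "pos x \<notin> path_image (lens v e f)"
    "Re (winding_number (lens v e f) (pos x)) = height v x e - height v x f"
proof -
  show *: "pos x \<notin> path_image (lens v e f)"
    using assms pos_notin_curve[of e x] pos_notin_curve[of f x]
    by (auto simp: star_def path_image_lens[of e f v w])
  show "Re (winding_number (lens v e f) (pos x)) = height v x e - height v x f"
    using winding_number_lens[OF _ _ _ _ _ *, of w] assms by (auto simp: star_def height_def)
qed

text \<open>The heights of two parallel edges differ by the winding number of their lens, which is 0
  outside and constantly 1 or constantly -1 inside. \<open>parallel_inside\<close> and
  \<open>parallel_outside\<close> supply the vertices that do and do not separate the two
  edges.\<close>

lemma card_star_le: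
  assumes "star v w \<noteq> {}" "verts G - {v, w} \<noteq> {}"
  shows "card (star v w) \<le> card (key v w ` (verts G - {v, w}))"
proof -
  let ?X = "verts G - {v, w}"
  have ends: "v \<in> verts G" "w \<in> verts G" "v \<noteq> w"
    using assms(1) ends_doubleton[of _ v w] by (auto simp: star_def)
  have closed: "path_image (closed_union (curve e) (curve f)) = path_image (lens v e f)"
    if "e \<in> star v w" "f \<in> star v w" "e \<noteq> f" for e f
    using that path_image_closed_union[of e f] path_image_lens[of e f v w] by (simp add: star_def)
  have on_lens: "pos v \<in> path_image (lens v e f)" "pos w \<in> path_image (lens v e f)"
    if "e \<in> star v w" "f \<in> star v w" "e \<noteq> f" for e f
    using that path_image_lens[of e f v w] out_curve[of e v w]
    by (auto simp: star_def) (metis pathstart_in_path_image pathfinish_in_path_image)+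
  show ?thesis unfolding key_def
  proof (rule card_le_card_separation_keys)
    show "finite ?X" using finite_verts by simp
    show "finite (star v w)" using finite_edges by (simp add: star_def)
  next
    fix e f assume ef: "e \<in> star v w" "f \<in> star v w" "e \<noteq> f"
    then have ef': "e \<in> edges G" "f \<in> edges G" "e \<noteq> f" "ends G e = {v, w}" "ends G f = {v, w}"
      by (auto simp: star_def)
    note simple = simple_lens[OF ef']
    have out0: "winding_number (lens v e f) z = 0" if "z \<in> outside (path_image (lens v e f))" for z
      using that simple winding_number_zero_in_outside simple_path_imp_path by blast
    have cases: "pos x \<in> inside (path_image (lens v e f)) \<or> pos x \<in> outside (path_image (lens v e f))"
      if "x \<in> ?X" for x
      using lens_height(1)[OF ef that] inside_Un_outside by blast
    show "(\<forall>x\<in>?X. height v x f - height v x e \<in> {0, 1}) \<or> (\<forall>x\<in>?X. height v x e - height v x f \<in> {0, 1})"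
      using simple(1)
    proof (rule simple_closed_path_winding_number_inside)
      assume "\<And>z. z \<in> inside (path_image (lens v e f)) \<Longrightarrow> winding_number (lens v e f) z = 1"
      then have "\<forall>x\<in>?X. height v x e - height v x f \<in> {0, 1}"
        using lens_height(2)[OF ef] cases out0 by (metis insertCI one_complex.simps(1) zero_complex.simps(1))
      then show ?thesis ..
    next
      assume "\<And>z. z \<in> inside (path_image (lens v e f)) \<Longrightarrow> winding_number (lens v e f) z = -1"
      then have "\<forall>x\<in>?X. height v x e - height v x f \<in> {0, -1}"
        using lens_height(2)[OF ef] cases out0
        by (metis insertCI one_complex.simps(1) uminus_complex.simps(1) zero_complex.simps(1))
      then have "\<forall>x\<in>?X. height v x f - height v x e \<in> {0, 1}"
        by (metis insert_iff minus_diff_eq minus_minus neg_equal_0_iff_equal singletonD)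
      then show ?thesis ..
    qed
    obtain x where x: "x \<in> verts G" "pos x \<in> inside (path_image (lens v e f))"
      using parallel_inside[of e f] ef' closed[OF ef] by auto
    then have xX: "x \<in> ?X" using on_lens[OF ef] inside_no_overlap by blast
    have "Re (winding_number (lens v e f) (pos x)) \<noteq> 0"
      using simple_closed_path_winding_number_inside[OF simple(1)] x(2)
      by (metis one_complex.simps(1) uminus_complex.simps(1) zero_neq_neg_one zero_neq_one)
    with lens_height(2)[OF ef xX] xX show "\<exists>x\<in>?X. height v x e \<noteq> height v x f" by auto
    obtain y where y: "y \<in> verts G" "pos y \<in> outside (path_image (lens v e f))"
      using parallel_outside[of e f] ef' closed[OF ef] by auto
    then have yX: "y \<in> ?X" using on_lens[OF ef] outside_no_overlap by blast
    with lens_height(2)[OF ef yX] out0[OF y(2)] show "\<exists>x\<in>?X. height v x e = height v x f" by auto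
  qed (use assms in auto)
qed

text \<open>
  If a lens at \<open>w\<close> separates \<open>x\<close> from \<open>w'\<close>, then its side containing \<open>x\<close> misses all edges from \<open>v\<close> to
  \<open>w'\<close>.  This side has \<open>w\<close> on its boundary, hence no lens at \<open>w'\<close> separates \<open>x\<close> from \<open>w\<close>.
\<close>

lemma key_compat:
  assumes "v \<in> verts G" "w \<in> verts G" "w' \<in> verts G" "x \<in> verts G"
    and neq: "w \<noteq> v" "w' \<noteq> v" "x \<noteq> v" "w \<noteq> w'" "x \<noteq> w" "x \<noteq> w'"
  shows "key v w x = key v w w' \<or> key v w' x = key v w' w"
proof (cases "key v w x = key v w w'")
  case False
  then obtain e f where ef: "e \<in> star v w" "f \<in> star v w"
    and height: "(height v x e = height v x f) \<noteq> (height v w' e = height v w' f)"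
    unfolding key_def by auto
  then have "e \<noteq> f" by auto
  with ef have ef': "e \<in> edges G" "f \<in> edges G" "e \<noteq> f" "ends G e = {v, w}" "ends G f = {v, w}"
    by (auto simp: star_def)
  define J where "J = path_image (lens v e f)"
  note simple = simple_lens[OF ef'] and sides = lens_sides[OF ef', folded J_def]
  have wn: "winding_number (lens v e f) (pos x) \<noteq> winding_number (lens v e f) (pos w')"
    using height lens_height(2)[OF ef \<open>e \<noteq> f\<close>, of x] lens_height(2)[OF ef \<open>e \<noteq> f\<close>, of w'] assms
    by auto
  have notin: "pos x \<notin> J" "pos w' \<notin> J"
    using lens_height(1)[OF ef \<open>e \<noteq> f\<close>] assms by (auto simp: J_def)
  have same: "pos x \<notin> C \<or> pos w' \<notin> C" if "C \<in> components (- J)" for C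
    using wn winding_number_eq[of "lens v e f" "pos x" C "pos w'"] simple
      in_components_connected[OF that] in_components_subset[OF that]
    by (auto simp: J_def simple_path_imp_path)
  have un: "inside J \<union> outside J = - J" by (rule inside_Un_outside)
  have "inside J \<noteq> outside J"
    using inside_Int_outside[of J] sides(1) in_components_nonempty by blast
  have "\<exists>A B. A \<in> components (- J) \<and> B \<in> components (- J) \<and> A \<noteq> B \<and> open A \<and> open B \<and>
      A \<union> B = - J \<and> frontier B = J \<and> pos w' \<in> A \<and> pos x \<in> B"
  proof (cases "pos x \<in> inside J")
    case True
    then have "pos w' \<in> outside J" using same[of "inside J"] sides(1) notin un by blast
    then show ?thesis using True sides \<open>inside J \<noteq> outside J\<close> un by (metis Un_commute)
  next
    case False
    then have "pos x \<in> outside J" using notin un by blast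
    moreover from this have "pos w' \<in> inside J" using same[of "outside J"] sides(2) notin un by blast
    ultimately show ?thesis using sides \<open>inside J \<noteq> outside J\<close> un by metis
  qed
  then obtain A B where AB: "A \<in> components (- J)" "B \<in> components (- J)" "A \<noteq> B" "open A" "open B"
      "A \<union> B = - J" and B: "frontier B = J" "pos w' \<in> A" "pos x \<in> B" by blast
  \<comment> \<open>The frontier of \<open>B\<close> is all of \<open>J\<close>, so
    \<open>pos w\<close>, a point of \<open>J\<close>, lies in the closure of
    \<open>B\<close>.\<close>
  have conn: "connected (insert (pos w) B)"
  proof (rule connected_intermediate_closure)
    show "connected B" using AB(2) in_components_connected by blast
    have "pos w \<in> J"
      unfolding J_def path_image_lens[OF ef']
      using out_curve[OF ef'(1,4)] by (metis UnI1 pathfinish_in_path_image)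
    then show "insert (pos w) B \<subseteq> closure B" using B(1) closure_subset by (auto simp: frontier_def)
  qed auto
  have "height v x e' = height v x f' \<longleftrightarrow> height v w e' = height v w f'"
    if ef2: "e' \<in> star v w'" "f' \<in> star v w'" for e' f'
  proof (cases "e' = f'")
    case False
    with ef2 have ef2': "e' \<in> edges G" "f' \<in> edges G" "e' \<noteq> f'" "ends G e' = {v, w'}" "ends G f' = {v, w'}"
      by (auto simp: star_def)
    have "path_image (curve g) \<inter> B = {}" if "g \<in> edges G" "ends G g = {v, w'}" for g
      by (rule adjacent_in_side[OF ef' that _ AB[unfolded J_def] B(2)]) (use neq in auto)
    then have "B \<inter> path_image (lens v e' f') = {}"
      using path_image_lens[OF ef2'] ef2' by blast
    moreover have "pos w \<notin> path_image (lens v e' f')"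
      using lens_height(1)[OF ef2 False, of w] assms by auto
    ultimately have "winding_number (lens v e' f') (pos x) = winding_number (lens v e' f') (pos w)"
      using simple_lens[OF ef2'] conn B(3)
      by (intro winding_number_eq[where S = "insert (pos w) B"]) (auto simp: simple_path_imp_path)
    then show ?thesis
      using lens_height(2)[OF ef2 False, of w] lens_height(2)[OF ef2 False, of x] assms by auto
  qed simp
  then show ?thesis unfolding key_def by blast
qed simp

text \<open>The edges at \<open>v\<close> are grouped by their other end \<open>w\<close>; each
  group is bounded by the number of labels at \<open>w\<close>, and the tree count over the other
  vertices bounds the sum.\<close>

lemma degree_le:
  assumes "v \<in> verts G" "card (verts G) \<ge> 3"
  shows "card {e \<in> edges G. v \<in> ends G e} \<le> 2 * (card (verts G) - 2)"
proof -
  define W where "W = verts G - {v}"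
  have W: "finite W" "card W = card (verts G) - 1" using assms finite_verts by (auto simp: W_def)
  have "{e \<in> edges G. v \<in> ends G e} \<subseteq> (\<Union>w\<in>W. star v w)"
  proof
    fix e assume "e \<in> {e \<in> edges G. v \<in> ends G e}"
    then have e: "e \<in> edges G" "v \<in> ends G e" by auto
    then obtain w where "ends G e = {v, w}"
      using no_loops[OF e(1)] by (metis card_2_iff doubleton_eq_iff empty_iff insert_iff)
    with ends_doubleton[OF e(1) this] e(1) show "e \<in> (\<Union>w\<in>W. star v w)" by (auto simp: W_def star_def)
  qed
  moreover have "finite (\<Union>w\<in>W. star v w)" using W(1) finite_edges by (simp add: star_def)
  ultimately have "card {e \<in> edges G. v \<in> ends G e} \<le> card (\<Union>w\<in>W. star v w)" by (rule card_mono[rotated])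
  also have "\<dots> \<le> (\<Sum>w\<in>W. card (star v w))" by (rule card_UN_le[OF W(1)])
  also have "\<dots> \<le> (\<Sum>w\<in>W. card (key v w ` (W - {w})))"
  proof (rule sum_mono)
    fix w assume "w \<in> W"
    have "W - {w} = verts G - {v, w}" by (auto simp: W_def)
    moreover have "W - {w} \<noteq> {}"
      using card_mono[of "{w}" W] W assms(2) by auto
    ultimately show "card (star v w) \<le> card (key v w ` (W - {w}))"
      using card_star_le[of v w] by (cases "star v w = {}") auto
  qed
  also have "\<dots> \<le> 2 * (card W - 1)"
    by (rule sum_card_image_separation_le) (use W assms key_compat in \<open>auto simp: W_def\<close>)
  finally show ?thesis using W(2) by simp
qed

text \<open>Handshake argument: the degrees add up to twice the number of edges.\<close>

lemma card_edges_le: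
  assumes "card (verts G) \<ge> 3"
  shows "card (edges G) \<le> card (verts G) * (card (verts G) - 2)"
proof -
  have "card {v \<in> verts G. v \<in> ends G e} = 2" if "e \<in> edges G" for e
  proof -
    have "{v \<in> verts G. v \<in> ends G e} = ends G e" using ends_in_verts[OF that] by blast
    with no_loops[OF that] show ?thesis by simp
  qed
  then have "2 * card (edges G) = (\<Sum>v\<in>verts G. card {e \<in> edges G. v \<in> ends G e})"
    by (intro sum_multicount[symmetric] finite_verts finite_edges) auto
  also have "\<dots> \<le> (\<Sum>v\<in>verts G. 2 * (card (verts G) - 2))"
    by (rule sum_mono) (rule degree_le[OF _ assms])
  finally show ?thesis by simp
qed

end

section \<open>Drawings with many edges\<close>

text \<open>
  The parabola over the segment between \<open>a\<close> and \<open>b\<close>, above the real axis if \<open>a < b\<close> and below it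
  otherwise.  All these parabolas have the same leading coefficient up to sign, so that two on
  the same side meet at most once.
\<close>

definition cap :: "real \<Rightarrow> real \<Rightarrow> real \<Rightarrow> complex" where
  "cap a b t = Complex (a + t * (b - a)) (sgn (b - a) * (t * (b - a)) * ((1 - t) * (b - a)))"

lemma cap_ends [simp]: "pathstart (cap a b) = of_real a" "pathfinish (cap a b) = of_real b"
  by (simp_all add: cap_def pathstart_def pathfinish_def complex_of_real_def)

lemma arc_cap: "a \<noteq> b \<Longrightarrow> arc (cap a b)"
  unfolding arc_def path_def cap_def[abs_def]
  by (auto intro!: continuous_intros inj_onI)

lemma path_image_cap:
  assumes "a \<noteq> b"
  shows "path_image (cap a b) =
    {z. min a b \<le> Re z \<and> Re z \<le> max a b \<and> Im z = sgn (b - a) * (Re z - a) * (b - Re z)}"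
proof (intro set_eqI iffI)
  fix z assume "z \<in> path_image (cap a b)"
  then obtain t where t: "0 \<le> t" "t \<le> 1" "z = cap a b t" by (auto simp: path_image_def)
  have "b - (a + t * (b - a)) = (1 - t) * (b - a)" by (simp add: algebra_simps)
  moreover have "min a b \<le> a + t * (b - a) \<and> a + t * (b - a) \<le> max a b"
  proof (cases "a \<le> b")
    case True
    with t mult_left_le_one_le[of "b - a" t] show ?thesis by simp
  next
    case False
    with t mult_left_le_one_le[of "a - b" t] mult_nonneg_nonneg[of t "a - b"] show ?thesis
      by (simp add: algebra_simps)
  qed
  ultimately show "z \<in> {z. min a b \<le> Re z \<and> Re z \<le> max a b \<and> Im z = sgn (b - a) * (Re z - a) * (b - Re z)}"
    using t(3) by (simp add: cap_def)
next
  fix z assume z: "z \<in> {z. min a b \<le> Re z \<and> Re z \<le> max a b \<and> Im z = sgn (b - a) * (Re z - a) * (b - Re z)}"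
  define t where "t = (Re z - a) / (b - a)"
  have t: "t * (b - a) = Re z - a" using assms by (simp add: t_def)
  have "0 \<le> t \<and> t \<le> 1"
  proof (cases "a < b")
    case True
    with z show ?thesis by (simp add: t_def)
  next
    case False
    with z assms show ?thesis by (simp add: t_def divide_nonpos_neg divide_le_eq)
  qed
  moreover have "(1 - t) * (b - a) = b - Re z" using t by (simp add: algebra_simps)
  then have "z = cap a b t" using z t by (simp add: cap_def complex_eq_iff)
  ultimately show "z \<in> path_image (cap a b)" by (auto simp: path_image_def)
qed

lemma Im_cap_ne_0: "a \<noteq> b \<Longrightarrow> t \<in> {0<..<1} \<Longrightarrow> Im (cap a b t) \<noteq> 0"
  by (auto simp: cap_def sgn_if)

lemma Im_cap_eq_0:
  assumes "a \<noteq> b" "z \<in> path_image (cap a b)" "Im z = 0"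
  shows "z = of_real a \<or> z = of_real b"
  using assms by (auto simp: path_image_cap complex_eq_iff sgn_if split: if_splits)

text \<open>Off the axis, the sign of \<open>Im z\<close> tells the side of the cap and its absolute
  value is the positive product; a common point thus equates two quadratics with the same leading
  coefficient.\<close>

lemma cap_meet:
  assumes "a \<noteq> b" "c \<noteq> d" "z \<in> path_image (cap a b)" "z \<in> path_image (cap c d)" "Im z \<noteq> 0"
  shows "a < b \<longleftrightarrow> c < d"
    "(Re z - a) * (b - Re z) = (Re z - c) * (d - Re z)"
    "Re z \<notin> {a, b, c, d}"
proof -
  have pos: "(Re z - a) * (b - Re z) > 0 \<and> (Im z > 0 \<longleftrightarrow> a < b) \<and> \<bar>Im z\<bar> = (Re z - a) * (b - Re z)"
    if "a \<noteq> b" "z \<in> path_image (cap a b)" for a b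
  proof -
    have z: "min a b \<le> Re z" "Re z \<le> max a b" "Im z = sgn (b - a) * ((Re z - a) * (b - Re z))"
      using that by (auto simp: path_image_cap)
    have "(Re z - a) * (b - Re z) \<noteq> 0" using z(3) assms(5) by auto
    moreover have "(Re z - a) * (b - Re z) \<ge> 0"
    proof (cases "a < b")
      case True
      with z(1,2) show ?thesis by simp
    next
      case False
      with z(1,2) show ?thesis by (intro mult_nonpos_nonpos) auto
    qed
    ultimately show ?thesis using z(3) that(1) by (auto simp: sgn_if less_le)
  qed
  from pos[OF assms(1,3)] pos[OF assms(2,4)]
  show "a < b \<longleftrightarrow> c < d" "(Re z - a) * (b - Re z) = (Re z - c) * (d - Re z)" "Re z \<notin> {a, b, c, d}"
    by auto
qed

text \<open>The difference of the two quadratics is linear and vanishes at the shared end, so a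
  second zero makes them equal. The caps would then coincide or lie on opposite sides.\<close>

lemma cap_meet_adjacent:
  assumes "a \<noteq> b" "c \<noteq> d" "{a, b} \<inter> {c, d} \<noteq> {}" "(a, b) \<noteq> (c, d)"
    and "z \<in> path_image (cap a b)" "z \<in> path_image (cap c d)"
  shows "Im z = 0"
proof (rule ccontr)
  assume "Im z \<noteq> 0"
  note meet = cap_meet[OF assms(1,2,5,6) this]
  from assms(3) consider "a = c" | "b = d" | "a = d" | "b = c" by auto
  then show False
  proof cases
    case 1
    with meet(2,3) assms(4) show False by auto
  next
    case 2
    with meet(2,3) assms(4) show False by auto
  next
    case 3
    with meet(2) have "(Re z - a) * (b - c) = 0" by (simp add: algebra_simps)
    with meet(1,3) 3 assms show False by auto
  next
    case 4
    with meet(2) have "(Re z - b) * (a - d) = 0" by (simp add: algebra_simps)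
    with meet(1,3) 4 assms show False by auto
  qed
qed

lemma cap_meet_unique:
  assumes "a \<noteq> b" "c \<noteq> d" "{a, b} \<inter> {c, d} = {}"
    and "z \<in> path_image (cap a b)" "z \<in> path_image (cap c d)" "Im z \<noteq> 0"
    and "z' \<in> path_image (cap a b)" "z' \<in> path_image (cap c d)" "Im z' \<noteq> 0"
  shows "z = z'"
proof -
  have eq: "(a + b - (c + d)) * Re z = a * b - c * d" "(a + b - (c + d)) * Re z' = a * b - c * d"
    using cap_meet(2)[OF assms(1,2,4-6)] cap_meet(2)[OF assms(1,2,7-9)]
    by (simp_all add: algebra_simps)
  \<comment> \<open>With equal sums the products would be equal too, and both pairs would be the
    roots of one quadratic.\<close>
  have "a + b \<noteq> c + d"
  proof
    assume ab: "a + b = c + d"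
    with eq(1) have "a * b = c * d" by simp
    moreover have "b = c + d - a" using ab by simp
    ultimately have "(a - c) * (a - d) = 0" by (simp add: algebra_simps)
    with assms(3) show False by auto
  qed
  then have "Re z = Re z'" using eq by (metis diff_eq_eq add_0 mult_left_cancel)
  then show ?thesis using assms(1,4,7) by (auto simp: path_image_cap complex_eq_iff)
qed

lemma finite_cap_Int:
  assumes "a \<noteq> b" "c \<noteq> d" "(a, b) \<noteq> (c, d)"
  shows "finite (path_image (cap a b) \<inter> path_image (cap c d))"
proof -
  define M where "M = {z \<in> path_image (cap a b) \<inter> path_image (cap c d). Im z \<noteq> 0}"
  have "z = z'" if "z \<in> M" "z' \<in> M" for z z'
  proof (cases "{a, b} \<inter> {c, d} = {}")
    case True
    with cap_meet_unique[OF assms(1,2)] that show ?thesis by (auto simp: M_def)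
  next
    case False
    with cap_meet_adjacent[OF assms(1,2) _ assms(3), of z] that show ?thesis by (auto simp: M_def)
  qed
  then have "M = {} \<or> (\<exists>z. M = {z})" by blast
  then have "finite M" by auto
  moreover have "path_image (cap a b) \<inter> path_image (cap c d) \<subseteq> {of_real a, of_real b} \<union> M"
    using Im_cap_eq_0[OF assms(1)] by (auto simp: M_def)
  ultimately show ?thesis by (meson finite.emptyI finite.insertI finite_UnI finite_subset)
qed

section \<open>Inside and outside of two opposite caps\<close>

lemma simple_path_cap_join:
  assumes "a \<noteq> b"
  shows "simple_path (cap a b +++ cap b a)"
proof (rule simple_path_join_loop)
  show "path_image (cap a b) \<inter> path_image (cap b a) \<subseteq> {pathstart (cap a b), pathstart (cap b a)}"
    using cap_meet_adjacent[of a b b a] Im_cap_eq_0[of a b] assms by auto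
qed (use assms arc_cap in auto)

lemma path_image_cap_join:
  assumes "a < b"
  shows "path_image (cap a b +++ cap b a) =
    {z. a \<le> Re z \<and> Re z \<le> b \<and> \<bar>Im z\<bar> = (Re z - a) * (b - Re z)}"
proof -
  have "z \<in> path_image (cap a b) \<longleftrightarrow> a \<le> Re z \<and> Re z \<le> b \<and> Im z = (Re z - a) * (b - Re z)"
    "z \<in> path_image (cap b a) \<longleftrightarrow> a \<le> Re z \<and> Re z \<le> b \<and> Im z = - ((Re z - a) * (b - Re z))" for z
    using assms by (auto simp: path_image_cap algebra_simps)
  moreover have "y = (x - a) * (b - x) \<or> y = - ((x - a) * (b - x)) \<longleftrightarrow> \<bar>y\<bar> = (x - a) * (b - x)"
    if "a \<le> x" "x \<le> b" for x y
  proof -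
    have "(x - a) * (b - x) \<ge> 0" using that by simp
    then show ?thesis by linarith
  qed
  ultimately show ?thesis unfolding path_image_join[of "cap a b" "cap b a", simplified] by blast
qed

text \<open>The vertical strip over the segment is convex and contains the curve.\<close>

lemma outside_cap_join:
  assumes "a < b" "x < a \<or> b < x"
  shows "of_real x \<in> outside (path_image (cap a b +++ cap b a))"
proof -
  have "convex {z. a \<le> Re z \<and> Re z \<le> b}"
    using convex_Int[OF convex_halfspace_Re_ge[of a] convex_halfspace_Re_le[of b]] by (simp add: Int_def)
  moreover have "path_image (cap a b +++ cap b a) \<subseteq> {z. a \<le> Re z \<and> Re z \<le> b}"
    using assms(1) by (auto simp: path_image_cap_join)
  ultimately have "- {z. a \<le> Re z \<and> Re z \<le> b} \<subseteq> outside (path_image (cap a b +++ cap b a))"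
    by (rule outside_subset_convex)
  moreover have "of_real x \<in> - {z. a \<le> Re z \<and> Re z \<le> b}" using assms(2) by auto
  ultimately show ?thesis by (rule subsetD)
qed

text \<open>\<open>R\<close> is bounded and its frontier lies on the curve, so the component of the
  complement containing the point cannot leave \<open>R\<close>.\<close>

lemma inside_cap_join:
  assumes "a < x" "x < b"
  shows "of_real x \<in> inside (path_image (cap a b +++ cap b a))"
proof -
  define J where "J = path_image (cap a b +++ cap b a)"
  have J: "J = {z. a \<le> Re z \<and> Re z \<le> b \<and> \<bar>Im z\<bar> = (Re z - a) * (b - Re z)}"
    unfolding J_def by (rule path_image_cap_join) (use assms in simp)
  define R where "R = {z. a < Re z \<and> Re z < b \<and> \<bar>Im z\<bar> < (Re z - a) * (b - Re z)}"
  define K where "K = {z. a \<le> Re z \<and> Re z \<le> b \<and> \<bar>Im z\<bar> \<le> (Re z - a) * (b - Re z)}"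
  have "open R" unfolding R_def
    by (intro open_Collect_conj open_Collect_less continuous_intros)
  have "closed K" unfolding K_def
    by (intro closed_Collect_conj closed_Collect_le continuous_intros)
  have "closure R \<subseteq> K" by (rule closure_minimal[OF _ \<open>closed K\<close>]) (auto simp: R_def K_def)
  moreover have "K - R \<subseteq> J"
  proof
    fix z assume z: "z \<in> K - R"
    have "\<not> \<bar>Im z\<bar> < (Re z - a) * (b - Re z)"
    proof
      assume *: "\<bar>Im z\<bar> < (Re z - a) * (b - Re z)"
      then have "Re z \<noteq> a" "Re z \<noteq> b" by auto
      with * z show False by (auto simp: K_def R_def)
    qed
    with z show "z \<in> J" by (auto simp: J K_def)
  qed
  ultimately have front: "frontier R \<subseteq> J"
    using \<open>open R\<close> by (auto simp: frontier_def interior_open)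
  have x: "of_real x \<in> R" "of_real x \<notin> J" using assms by (auto simp: R_def J)
  let ?C = "connected_component_set (- J) (of_real x)"
  have "?C \<subseteq> R"
  proof (rule ccontr)
    assume "\<not> ?C \<subseteq> R"
    moreover have "of_real x \<in> ?C \<inter> R" using x by (simp add: connected_component_refl)
    ultimately have "?C \<inter> frontier R \<noteq> {}"
      by (intro connected_Int_frontier connected_connected_component) blast+
    with front connected_component_subset[of "- J" "of_real x"] show False by blast
  qed
  moreover have "bounded R"
  proof (rule bounded_subset[OF bounded_cbox])
    have "\<bar>Im z\<bar> \<le> (b - a) * (b - a)" if "z \<in> R" for z
      using that mult_mono[of "Re z - a" "b - a" "b - Re z" "b - a"] by (auto simp: R_def)
    then show "R \<subseteq> cbox (Complex a (- ((b - a) * (b - a)))) (Complex b ((b - a) * (b - a)))"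
      by (force simp: in_cbox_complex_iff R_def abs_le_iff)
  qed
  ultimately have "bounded ?C" using bounded_subset by blast
  with x(2) show ?thesis unfolding J_def[symmetric] inside_def by simp
qed

section \<open>Points in general position\<close>

text \<open>
  The determinant that vanishes if the lines \<open>y = (a + b) x - a b\<close>, \<open>y = (c + d) x - c d\<close> and
  \<open>y = (e + f) x - e f\<close> are concurrent; subtracting \<open>x\<^sup>2\<close> from the right-hand sides gives the three
  parabolas.
\<close>

definition concurrence :: "real \<Rightarrow> real \<Rightarrow> real \<Rightarrow> real \<Rightarrow> real \<Rightarrow> real \<Rightarrow> real" where
  "concurrence a b c d e f =
    (a + b) * (c * d - e * f) + (c + d) * (e * f - a * b) + (e + f) * (a * b - c * d)"

text \<open>Distinct caps through a common point off the axis have pairwise disjoint ends, so only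
  six distinct values matter.\<close>

definition generic :: "real set \<Rightarrow> bool" where
  "generic S \<longleftrightarrow> (\<forall>a\<in>S. \<forall>b\<in>S. \<forall>c\<in>S. \<forall>d\<in>S. \<forall>e\<in>S. \<forall>f\<in>S.
    distinct [a, b, c, d, e, f] \<longrightarrow> concurrence a b c d e f \<noteq> 0)"

lemma concurrence_eq_0:
  assumes "(x - a) * (b - x) = (x - c) * (d - x)" "(x - a) * (b - x) = (x - e) * (f - x)"
  shows "concurrence a b c d e f = 0"
proof -
  have "(a + b - (c + d)) * x = a * b - c * d" "(a + b - (e + f)) * x = a * b - e * f"
    using assms by (simp_all add: algebra_simps)
  then have "(a + b - (c + d)) * (a * b - e * f) = (a + b - (e + f)) * (a * b - c * d)"
    by (metis mult.assoc mult.left_commute)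
  then show ?thesis by (simp add: concurrence_def algebra_simps)
qed

text \<open>Enough symmetry to bring any argument to the front.\<close>

lemma concurrence_perm:
  "concurrence b a c d e f = concurrence a b c d e f"
  "concurrence c d a b e f = - concurrence a b c d e f"
  "concurrence e f c d a b = - concurrence a b c d e f"
  by (simp_all add: concurrence_def algebra_simps)

lemma finite_concurrence_roots:
  assumes "distinct [b, c, d, e, f]"
  shows "finite {y. concurrence y b c d e f = 0}"
proof -
  define A where "A = c * d - e * f - b * (c + d) + (e + f) * b"
  define B where "B = b * (c * d - e * f) + (c + d) * (e * f) - (e + f) * (c * d)"
  have lin: "concurrence y b c d e f = A * y + B" for y
    by (simp add: concurrence_def A_def B_def algebra_simps)
  \<comment> \<open>This value at \<open>y = c\<close> shows that the affine function of
    \<open>y\<close> does not vanish identically.\<close>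
  have "concurrence c b c d e f = (d - b) * (c - e) * (c - f)"
    by (simp add: concurrence_def algebra_simps)
  then have "A * c + B \<noteq> 0" using assms by (auto simp: lin)
  have "y = - B / A" if "A * y + B = 0" for y
    using that \<open>A * c + B \<noteq> 0\<close> by (cases "A = 0") (auto simp: field_simps)
  then have "{y. concurrence y b c d e f = 0} \<subseteq> {- B / A}" by (auto simp: lin)
  then show ?thesis by (rule finite_subset) simp
qed

text \<open>Points are added one at a time, each avoiding the finitely many zeros of
  \<open>concurrence\<close> that the previous ones determine.\<close>

lemma ex_generic: "\<exists>S. finite S \<and> card S = n \<and> generic S"
proof (induction n)
  case 0
  show ?case by (intro exI[of _ "{}"]) (simp add: generic_def)
next
  case (Suc n)
  then obtain S where S: "finite S" "card S = n" "generic S" by blast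
  define bad where "bad = S \<union> (\<Union>b\<in>S. \<Union>c\<in>S. \<Union>d\<in>S. \<Union>e\<in>S. \<Union>f\<in>S.
    if distinct [b, c, d, e, f] then {y. concurrence y b c d e f = 0} else {})"
  have "finite bad" unfolding bad_def
    using S(1) finite_concurrence_roots by (intro finite_UnI finite_UN_I) (auto split: if_splits)
  then obtain y where y: "y \<notin> bad" using ex_new_if_finite infinite_UNIV_char_0 by blast
  then have "y \<notin> S" by (simp add: bad_def)
  have new: "concurrence y b c d e f \<noteq> 0"
    if "b \<in> S" "c \<in> S" "d \<in> S" "e \<in> S" "f \<in> S" "distinct [b, c, d, e, f]" for b c d e f
    using y that unfolding bad_def by fastforce
  have "generic (insert y S)"
    unfolding generic_def
  proof (intro ballI impI)
    fix a b c d e f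
    assume mem: "a \<in> insert y S" "b \<in> insert y S" "c \<in> insert y S" "d \<in> insert y S" "e \<in> insert y S" "f \<in> insert y S"
      and dist: "distinct [a, b, c, d, e, f]"
    consider "{a, b, c, d, e, f} \<subseteq> S" | "a = y" | "b = y" | "c = y" | "d = y" | "e = y" | "f = y"
      using mem by blast
    then show "concurrence a b c d e f \<noteq> 0"
    proof cases
      case 1
      with S(3) dist show ?thesis by (auto simp: generic_def)
    next
      case 2
      with mem dist new[of b c d e f] show ?thesis by auto
    next
      case 3
      with mem dist new[of a c d e f] concurrence_perm(1)[of a b c d e f] show ?thesis by auto
    next
      case 4
      with mem dist new[of d a b e f] concurrence_perm(2)[of c d a b e f] show ?thesis by auto
    next
      case 5
      with mem dist new[of c a b e f] concurrence_perm(1)[of d c a b e f] concurrence_perm(2)[of c d a b e f]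
      show ?thesis by auto
    next
      case 6
      with mem dist new[of f c d a b] concurrence_perm(3)[of e f c d a b] show ?thesis by auto
    next
      case 7
      with mem dist new[of e c d a b] concurrence_perm(1)[of f e c d a b] concurrence_perm(3)[of e f c d a b]
      show ?thesis by auto
    qed
  qed
  then show ?case using S \<open>y \<notin> S\<close> by (intro exI[of _ "insert y S"]) simp
qed

lemma ex_generic_sequence:
  obtains x :: "nat \<Rightarrow> real" where "strict_mono_on {..<n} x" "generic (x ` {..<n})"
proof -
  obtain S where S: "finite S" "card S = n" "generic S" using ex_generic by blast
  define x where "x = (!) (sorted_list_of_set S)"
  have "strict_mono_on {..<n} x"
    unfolding x_def using S by (auto intro!: strict_mono_onI sorted_wrt_nth_less[OF strict_sorted_list_of_set])
  moreover have "x ` {..<n} = S"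
    unfolding x_def using S nth_image[of n "sorted_list_of_set S"] by (simp add: lessThan_atLeast0)
  ultimately show ?thesis using that S(3) by blast
qed

section \<open>The extremal drawing\<close>

text \<open>
  All pairs of vertices are joined both above and below the axis, except that cyclically
  consecutive ones are joined only once.
\<close>

definition capped_pairs :: "nat \<Rightarrow> (nat \<times> nat) set" where
  "capped_pairs n = {(i, j). i < n \<and> j < n \<and> i \<noteq> j \<and> i \<noteq> Suc j mod n}"

lemma finite_capped_pairs: "finite (capped_pairs n)"
  by (rule finite_subset[of _ "{..<n} \<times> {..<n}"]) (auto simp: capped_pairs_def)

lemma card_capped_pairs:
  assumes "n \<ge> 2"
  shows "card (capped_pairs n) = n * (n - 2)"
proof -
  have "capped_pairs n = prod.swap ` (SIGMA j:{..<n}. {..<n} - {j, Suc j mod n})"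
    by (force simp: capped_pairs_def)
  then have "card (capped_pairs n) = card (SIGMA j:{..<n}. {..<n} - {j, Suc j mod n})"
    by (simp add: card_image)
  also have "\<dots> = (\<Sum>j<n. card ({..<n} - {j, Suc j mod n}))"
    by (rule card_SigmaI) auto
  also have "\<dots> = (\<Sum>j<n. n - 2)"
  proof (rule sum.cong)
    fix j assume "j \<in> {..<n}"
    moreover from this have "j \<noteq> Suc j mod n" using assms by (cases "Suc j = n") auto
    ultimately show "card ({..<n} - {j, Suc j mod n}) = n - 2"
      using assms by (subst card_Diff_subset) auto
  qed simp
  finally show ?thesis by simp
qed

lemma ex_branching_drawing:
  assumes "n \<ge> 3"
  shows "\<exists>(G :: (nat, nat) multigraph) pos curve.
    branching_drawing G pos curve \<and> card (verts G) = n \<and> card (edges G) = n * (n - 2)"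
proof -
  obtain x where mono: "strict_mono_on {..<n} x" and gen: "generic (x ` {..<n})"
    using ex_generic_sequence .
  have x_less: "x i < x j \<longleftrightarrow> i < j" and x_eq: "x i = x j \<longleftrightarrow> i = j" if "i < n" "j < n" for i j
    using strict_mono_on_less[OF mono, of i j] strict_mono_on_eq[OF mono, of i j] that by auto
  \<comment> \<open>Encoding the pairs as natural numbers gives edges of the required type; swapping
    a pair reflects its cap in the axis.\<close>
  define G :: "(nat, nat) multigraph" where "G = \<lparr>verts = {..<n},
    edges = prod_encode ` capped_pairs n, ends = (\<lambda>e. {fst (prod_decode e), snd (prod_decode e)})\<rparr>"
  define pos where "pos i = complex_of_real (x i)" for i
  define curve where "curve e = cap (x (fst (prod_decode e))) (x (snd (prod_decode e)))" for e
  have sel: "verts G = {..<n}" "edges G = prod_encode ` capped_pairs n"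
    "ends G (prod_encode (i, j)) = {i, j}" "curve (prod_encode (i, j)) = cap (x i) (x j)" for i j
    by (simp_all add: G_def curve_def)
  have edgeE: thesis if "e \<in> edges G"
      "\<And>i j. \<lbrakk>e = prod_encode (i, j); i < n; j < n; i \<noteq> j; i \<noteq> Suc j mod n; x i \<noteq> x j\<rbrakk> \<Longrightarrow> thesis"
    for e thesis
    using that x_eq by (auto simp: sel capped_pairs_def)
  have card: "card (verts G) = n" "card (edges G) = n * (n - 2)"
    using card_capped_pairs assms inj_prod_encode by (simp_all add: sel card_image)
  have Im_0: "p \<in> pos ` verts G" if "e \<in> edges G" "p \<in> path_image (curve e)" "Im p = 0" for e p
    using that(1)
  proof (rule edgeE)
    fix i j assume "e = prod_encode (i, j)" "i < n" "j < n" "x i \<noteq> x j"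
    with Im_cap_eq_0[of "x i" "x j" p] that show ?thesis by (auto simp: sel pos_def)
  qed
  have adjacent: "Im p = 0"
    if "e \<in> edges G" "f \<in> edges G" "e \<noteq> f" "ends G e \<inter> ends G f \<noteq> {}"
      "p \<in> path_image (curve e)" "p \<in> path_image (curve f)" for e f p
    using that(1)
  proof (rule edgeE)
    fix i j assume e: "e = prod_encode (i, j)" "i < n" "j < n" "x i \<noteq> x j"
    show "Im p = 0"
      using that(2)
    proof (rule edgeE)
      fix k l assume f: "f = prod_encode (k, l)" "k < n" "l < n" "x k \<noteq> x l"
      show "Im p = 0"
        by (rule cap_meet_adjacent[of "x i" "x j" "x k" "x l"]) (use e f that x_eq in \<open>auto simp: sel\<close>)
    qed
  qed
  have crossing: "p \<in> path_image (curve e)" "p \<in> path_image (curve f)" "Im p \<noteq> 0"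
    if cr: "e \<in> edges G" "f \<in> edges G" "crosses_at (curve e) (curve f) p" for e f p
  proof -
    obtain s t where st: "s \<in> {0<..<1}" "t \<in> {0<..<1}" "curve e s = p" "curve f t = p"
      using cr(3) unfolding crosses_at_def by blast
    then show "p \<in> path_image (curve e)" "p \<in> path_image (curve f)"
      using imageI[of s "{0..1}" "curve e"] imageI[of t "{0..1}" "curve f"] by (simp_all add: path_image_def)
    \<comment> \<open>A crossing has parameters strictly between 0 and 1, hence lies off the
      axis.\<close>
    show "Im p \<noteq> 0" using cr(1)
      by (rule edgeE) (use Im_cap_ne_0 st in \<open>auto simp: sel\<close>)
  qed
  have parallel: "simple_path (closed_union (curve e) (curve f)) \<and>
      (\<exists>v\<in>verts G. pos v \<in> inside (path_image (closed_union (curve e) (curve f)))) \<and>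
      (\<exists>v\<in>verts G. pos v \<in> outside (path_image (closed_union (curve e) (curve f))))"
    if ef: "e \<in> edges G" "f \<in> edges G" "e \<noteq> f" "ends G e = ends G f" for e f
    using ef(1)
  proof (rule edgeE)
    fix i j assume e: "e = prod_encode (i, j)" "i < n" "j < n" "i \<noteq> j" "i \<noteq> Suc j mod n" "x i \<noteq> x j"
    \<comment> \<open>Parallel edges are the two caps over one segment. As neither pair is omitted,
      \<open>i\<close> and \<open>j\<close> are not cyclic neighbours.\<close>
    have f: "f = prod_encode (j, i)" "j \<noteq> Suc i mod n"
    proof -
      obtain k l where kl: "f = prod_encode (k, l)" "k \<noteq> Suc l mod n" using ef(2) by (rule edgeE)
      with ef e(1) have "k = j" "l = i" by (auto simp: sel(3) doubleton_eq_iff)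
      with kl show "f = prod_encode (j, i)" "j \<noteq> Suc i mod n" by auto
    qed
    have cu: "closed_union (curve e) (curve f) = cap (x i) (x j) +++ cap (x j) (x i)"
      by (simp add: e f sel closed_union_def)
    have commute: "path_image (cap (x i) (x j) +++ cap (x j) (x i)) = path_image (cap (x j) (x i) +++ cap (x i) (x j))"
      by (simp add: path_image_join Un_commute)
    define l h where "l = min i j" and "h = max i j"
    have lh: "l < h" "h < n" "h \<noteq> Suc l" "\<not> (l = 0 \<and> h = n - 1)"
      using e f by (auto simp: l_def h_def min_def max_def)
    have im: "path_image (closed_union (curve e) (curve f)) = path_image (cap (x l) (x h) +++ cap (x h) (x l))"
      using commute unfolding cu l_def h_def by (auto simp: min_def max_def)
    \<comment> \<open>Since \<open>l\<close> and \<open>h\<close> are not cyclic neighbours,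
      \<open>Suc l\<close> lies strictly between them; \<open>0\<close> lies before \<open>l\<close>
      or, if \<open>l = 0\<close>, \<open>n - 1\<close> lies beyond \<open>h\<close>.\<close>
    have "pos (Suc l) \<in> inside (path_image (closed_union (curve e) (curve f)))"
      unfolding im pos_def by (rule inside_cap_join) (use lh x_less in auto)
    moreover have "pos (if l = 0 then n - 1 else 0) \<in> outside (path_image (closed_union (curve e) (curve f)))"
      unfolding im pos_def by (rule outside_cap_join) (use lh x_less in auto)
    moreover have "Suc l \<in> verts G" "(if l = 0 then n - 1 else 0) \<in> verts G" using lh assms by (auto simp: sel)
    ultimately show ?thesis using simple_path_cap_join[OF e(6)] unfolding cu by blast
  qed
  have "branching_drawing G pos curve"
  proof unfold_locales
    show "finite (verts G)" "finite (edges G)" by (simp_all add: sel finite_capped_pairs)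
    show "inj_on pos (verts G)" using x_eq by (auto simp: pos_def sel inj_on_def)
    fix e assume e: "e \<in> edges G"
    obtain i j where ij: "e = prod_encode (i, j)" "i < n" "j < n" "i \<noteq> j" "x i \<noteq> x j" using e by (rule edgeE)
    show "ends G e \<subseteq> verts G" "card (ends G e) = 2" "arc (curve e)"
      "{pathstart (curve e), pathfinish (curve e)} = pos ` ends G e"
      using ij by (auto simp: sel pos_def arc_cap)
    show "v \<in> ends G e" if "v \<in> verts G" "pos v \<in> path_image (curve e)" for v
      using Im_cap_eq_0[of "x i" "x j" "pos v"] that ij x_eq by (auto simp: sel pos_def)
    fix f assume f: "f \<in> edges G"
    obtain k l where kl: "f = prod_encode (k, l)" "k < n" "l < n" "k \<noteq> l" "x k \<noteq> x l" using f by (rule edgeE)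
    show "finite (path_image (curve e) \<inter> path_image (curve f))" if "e \<noteq> f"
      using ij kl that x_eq by (auto simp: sel intro!: finite_cap_Int)
    show "\<not> crosses_at (curve e) (curve f) p" if "e \<noteq> f" "ends G e \<inter> ends G f \<noteq> {}" for p
      using crossing[OF e f] adjacent[OF e f that] by blast
    show "p = q" if "ends G e \<inter> ends G f = {}" "crosses_at (curve e) (curve f) p" "crosses_at (curve e) (curve f) q" for p q
      by (rule cap_meet_unique[of "x i" "x j" "x k" "x l"])
        (use ij kl that(1) x_eq crossing[OF e f that(2)] crossing[OF e f that(3)] in \<open>auto simp: sel\<close>)
    fix g p assume g: "g \<in> edges G" and ne: "e \<noteq> f" "e \<noteq> g" "f \<noteq> g"
      and p: "p \<in> path_image (curve e)" "p \<in> path_image (curve f)" "p \<in> path_image (curve g)"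
    show "p \<in> pos ` verts G"
    proof (rule ccontr)
      assume "p \<notin> pos ` verts G"
      with Im_0 e p(1) have Im: "Im p \<noteq> 0" by blast
      obtain h m where hm: "g = prod_encode (h, m)" "h < n" "m < n" "h \<noteq> m" "x h \<noteq> x m" using g by (rule edgeE)
      \<comment> \<open>Edges meeting off the axis have no common end, so a triple point would
        involve six distinct vertices, contradicting genericity.\<close>
      have "ends G e \<inter> ends G f = {}" "ends G e \<inter> ends G g = {}" "ends G f \<inter> ends G g = {}"
        using adjacent e f g ne p Im by blast+
      then have "distinct [i, j, k, l, h, m]" using ij kl hm by (auto simp: sel)
      then have "distinct [x i, x j, x k, x l, x h, x m]" using ij kl hm x_eq by simp
      with gen ij kl hm have "concurrence (x i) (x j) (x k) (x l) (x h) (x m) \<noteq> 0"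
        unfolding generic_def by blast
      moreover have "concurrence (x i) (x j) (x k) (x l) (x h) (x m) = 0"
        by (rule concurrence_eq_0[of "Re p"]; rule cap_meet(2)) (use ij kl hm p Im in \<open>auto simp: sel\<close>)
      ultimately show False by simp
    qed
  qed (use parallel in blast)+
  with card show ?thesis by blast
qed

theorem theorem3:
  shows "(\<forall>(G :: ('v, 'e) multigraph) pos curve.
            branching_drawing G pos curve \<and> card (verts G) \<ge> 3 \<longrightarrow>
            card (edges G) \<le> card (verts G) * (card (verts G) - 2))
       \<and> (\<forall>n\<ge>3. \<exists>(G :: (nat, nat) multigraph) pos curve.
            branching_drawing G pos curve \<and> card (verts G) = n \<and> card (edges G) = n * (n - 2))"
  using branching_drawing.card_edges_le ex_branching_drawing by blast

end
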